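(* Consider the contract design problem (P): maximize $$\sum_{n=1}^{N}\sum_{k=1}^{K}\pi_{kn}\bigl(U(\gamma_k)-t_k\bigr)$$ over all menus $(\gamma_k,t_k)_{k=1}^K$ with $\gamma_k\ge 0$ and $t_k\in\mathbb{R}$, subject to $$t_k-\frac{c\gamma_k}{\delta_k}\ge 0\quad\text{for all }k\in\{1,\dots,K\}\qquad(\mathrm{IR}_k)$$ and $$t_k-\frac{c\gamma_k}{\delta_k}\ge t_j-\frac{c\gamma_j}{\delta_k}\quad\text{for all }k,j\in\{1,\dots,K\}\qquad(\mathrm{IC}_{k,j}).$$ Then: 1. Every optimal solution of (P) satisfies $0\le\gamma_1\le\gamma_2\le\cdots\le\gamma_K$, and all the downward adjacent incentive compatibility constraints are binding at it: $$t_k-\frac{c\gamma_k}{\delta_k}=t_{k-1}-\frac{c\gamma_{k-1}}{\delta_k}\qquad\text{for all }k\in\{2,\dots,K\}.$$ 2. The other incentive compatibility constraints can be ignored: every menu $(\gamma_k,t_k)_{k=1}^K$ with $0\le\gamma_1\le\gamma_2\le\cdots\le\gamma_K$ that satisfies the equalities in item 1 for all $k\in\{2,\dots,K\}$ satisfies $(\mathrm{IC}_{k,j})$ for all $k,j\in\{1,\dots,K\}$.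
   Context: $N\ge 1$ (number of subcarriers) and $K\ge 1$ (number of relay types) are integers. The relay types are real numbers $0<\delta_1<\delta_2<\cdots<\delta_K$. The constant $c>0$ is the cost per unit power, and a relay of type $\delta$ providing SNR $\gamma\ge0$ incurs cost $c\gamma/\delta$. For each subcarrier $n\in\{1,\dots,N\}$, $(\pi_{1n},\dots,\pi_{Kn})$ is a probability vector with strictly positive entries: $\pi_{kn}>0$ and $\sum_{k=1}^K\pi_{kn}=1$. $U:[0,\infty)\to\mathbb{R}$ is a concave function (the source's utility of SNR; the model example is $U(\gamma)=\tfrac12\log_2(1+\gamma)$). A contract $(\gamma_k,t_k)$ consists of an SNR $\gamma_k$ and a transfer $t_k$ intended for type $\delta_k$. An optimal solution of (P) is a feasible menu attaining the maximum of the objective over all feasible menus. *)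

theory Defs
  imports "HOL-Analysis.Analysis"
begin

text \<open>
  Relay types and menu items are indexed by \<open>{1..K}\<close>, subcarriers by \<open>{1..N}\<close>. A menu is a pair of
  functions \<open>\<gamma> t :: nat \<Rightarrow> real\<close> (SNRs and transfers) of which only the values on \<open>{1..K}\<close> matter.
\<close>

definition relay_cost :: "real \<Rightarrow> real \<Rightarrow> real \<Rightarrow> real" where
  "relay_cost c d g = c * g / d"

definition IR :: "real \<Rightarrow> (nat \<Rightarrow> real) \<Rightarrow> (nat \<Rightarrow> real) \<Rightarrow> (nat \<Rightarrow> real) \<Rightarrow> nat \<Rightarrow> bool" where
  "IR c \<delta> \<gamma> t k \<longleftrightarrow> t k - relay_cost c (\<delta> k) (\<gamma> k) \<ge> 0"

definition IC :: "real \<Rightarrow> (nat \<Rightarrow> real) \<Rightarrow> (nat \<Rightarrow> real) \<Rightarrow> (nat \<Rightarrow> real) \<Rightarrow> nat \<Rightarrow> nat \<Rightarrow> bool" where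
  "IC c \<delta> \<gamma> t k j \<longleftrightarrow>
     t k - relay_cost c (\<delta> k) (\<gamma> k) \<ge> t j - relay_cost c (\<delta> k) (\<gamma> j)"

definition feasible :: "nat \<Rightarrow> real \<Rightarrow> (nat \<Rightarrow> real) \<Rightarrow> (nat \<Rightarrow> real) \<Rightarrow> (nat \<Rightarrow> real) \<Rightarrow> bool" where
  "feasible K c \<delta> \<gamma> t \<longleftrightarrow>
     (\<forall>k\<in>{1..K}. \<gamma> k \<ge> 0) \<and>
     (\<forall>k\<in>{1..K}. IR c \<delta> \<gamma> t k) \<and>
     (\<forall>k\<in>{1..K}. \<forall>j\<in>{1..K}. IC c \<delta> \<gamma> t k j)"

definition objective ::
  "nat \<Rightarrow> nat \<Rightarrow> (nat \<Rightarrow> nat \<Rightarrow> real) \<Rightarrow> (real \<Rightarrow> real) \<Rightarrow> (nat \<Rightarrow> real) \<Rightarrow> (nat \<Rightarrow> real) \<Rightarrow> real" where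
  "objective N K \<pi> U \<gamma> t = (\<Sum>n=1..N. \<Sum>k=1..K. \<pi> k n * (U (\<gamma> k) - t k))"

definition optimal ::
  "nat \<Rightarrow> nat \<Rightarrow> real \<Rightarrow> (nat \<Rightarrow> real) \<Rightarrow> (nat \<Rightarrow> nat \<Rightarrow> real) \<Rightarrow> (real \<Rightarrow> real) \<Rightarrow>
     (nat \<Rightarrow> real) \<Rightarrow> (nat \<Rightarrow> real) \<Rightarrow> bool" where
  "optimal N K c \<delta> \<pi> U \<gamma> t \<longleftrightarrow>
     feasible K c \<delta> \<gamma> t \<and>
     (\<forall>\<gamma>' t'. feasible K c \<delta> \<gamma>' t' \<longrightarrow> objective N K \<pi> U \<gamma>' t' \<le> objective N K \<pi> U \<gamma> t)"

definition monotone_snr :: "nat \<Rightarrow> (nat \<Rightarrow> real) \<Rightarrow> bool" where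
  "monotone_snr K \<gamma> \<longleftrightarrow> 0 \<le> \<gamma> 1 \<and> (\<forall>k\<in>{2..K}. \<gamma> (k - 1) \<le> \<gamma> k)"

definition downward_binding ::
  "nat \<Rightarrow> real \<Rightarrow> (nat \<Rightarrow> real) \<Rightarrow> (nat \<Rightarrow> real) \<Rightarrow> (nat \<Rightarrow> real) \<Rightarrow> bool" where
  "downward_binding K c \<delta> \<gamma> t \<longleftrightarrow>
     (\<forall>k\<in>{2..K}. t k - relay_cost c (\<delta> k) (\<gamma> k) =
                  t (k - 1) - relay_cost c (\<delta> k) (\<gamma> (k - 1)))"

end

theory Submission
  imports Defs
begin

text \<open>
  In terms of the unit cost \<open>a k = c / \<delta> k\<close>, which decreases in the type, \<open>IC\<^sub>k\<^sub>j\<close> reads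
  \<open>t j - t k \<le> a k * (\<gamma> j - \<gamma> k)\<close>. Adding \<open>IC\<^sub>k\<^sub>j\<close> and \<open>IC\<^sub>j\<^sub>k\<close> gives monotonicity of \<open>\<gamma>\<close>.
  If the downward adjacent constraint of type \<open>m\<close> had slack \<open>\<epsilon> > 0\<close>, then lowering all transfers of
  the types \<open>k \<ge> m\<close> by \<open>\<epsilon>\<close> would keep the menu feasible and strictly increase the objective.
  Conversely, summing the binding adjacent constraints bounds \<open>t k - t j\<close> on both sides, because
  all unit costs that occur lie between \<open>a k\<close> and \<open>a j\<close>.
\<close>

lemma relay_cost_eq: "relay_cost c d g = c / d * g"
  by (simp add: relay_cost_def)

lemma IC_iff: "IC c \<delta> \<gamma> t k j \<longleftrightarrow> t j - t k \<le> c / \<delta> k * (\<gamma> j - \<gamma> k)"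
  by (auto simp: IC_def relay_cost_eq right_diff_distrib)

lemma unit_cost_antimono:
  fixes c :: real and \<delta> :: "nat \<Rightarrow> real"
  assumes "c > 0" and "\<And>k. k \<in> {1..K} \<Longrightarrow> \<delta> k > 0" and "strict_mono_on {1..K} \<delta>"
    and "1 \<le> j" "j < k" "k \<le> K"
  shows "c / \<delta> k < c / \<delta> j"
proof -
  have "\<delta> j < \<delta> k"
    using assms by (auto intro: strict_mono_onD)
  with assms(2)[of j] assms show ?thesis
    by (intro divide_strict_left_mono) (auto intro!: mult_pos_pos)
qed

lemma incentive_compatible_imp_mono:
  fixes a \<gamma> t :: "nat \<Rightarrow> real"
  assumes "a k < a j" and "t j - t k \<le> a k * (\<gamma> j - \<gamma> k)" and "t k - t j \<le> a j * (\<gamma> k - \<gamma> j)"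
  shows "\<gamma> j \<le> \<gamma> k"
proof -
  have "0 \<le> (a j - a k) * (\<gamma> k - \<gamma> j)"
    using assms(2,3) by (simp add: algebra_simps)
  with assms(1) show ?thesis
    by (simp add: zero_le_mult_iff)
qed

text \<open>The two bounds are the constraints of \<open>k\<close> against \<open>j\<close> and of
  \<open>j\<close> against \<open>k\<close>. Monotonicity of \<open>\<gamma>\<close> is carried
  through the induction because it fixes the sign of the differences that the unit costs
  multiply.\<close>

lemma binding_adjacent_imp_bounds:
  fixes a \<gamma> t :: "nat \<Rightarrow> real"
  assumes anti: "\<And>i l. 1 \<le> i \<Longrightarrow> i < l \<Longrightarrow> l \<le> K \<Longrightarrow> a l < a i"
    and mono: "\<And>k. k \<in> {2..K} \<Longrightarrow> \<gamma> (k - 1) \<le> \<gamma> k"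
    and bind: "\<And>k. k \<in> {2..K} \<Longrightarrow> t k - t (k - 1) = a k * (\<gamma> k - \<gamma> (k - 1))"
    and "1 \<le> j" "j \<le> k" "k \<le> K"
  shows "\<gamma> j \<le> \<gamma> k \<and> a k * (\<gamma> k - \<gamma> j) \<le> t k - t j \<and> t k - t j \<le> a j * (\<gamma> k - \<gamma> j)"
  using \<open>j \<le> k\<close> \<open>k \<le> K\<close>
proof (induction k rule: dec_induct)
  case base
  show ?case by simp
next
  case (step k)
  have up: "\<gamma> k \<le> \<gamma> (Suc k)" and eq: "t (Suc k) - t k = a (Suc k) * (\<gamma> (Suc k) - \<gamma> k)"
    using mono[of "Suc k"] bind[of "Suc k"] step \<open>1 \<le> j\<close> by auto
  have IH: "\<gamma> j \<le> \<gamma> k" "a k * (\<gamma> k - \<gamma> j) \<le> t k - t j" "t k - t j \<le> a j * (\<gamma> k - \<gamma> j)"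
    using step by auto
  \<comment> \<open>The old lower bound is weakened to the new unit cost \<open>a (Suc k)\<close>,
    so that the new increment, priced at the same rate, can be added. For the upper bound it is the
    new increment that is repriced, at \<open>a j\<close>.\<close>
  have "a (Suc k) * (\<gamma> k - \<gamma> j) \<le> a k * (\<gamma> k - \<gamma> j)"
    using IH(1) anti[of k "Suc k"] step \<open>1 \<le> j\<close> by (intro mult_right_mono) auto
  moreover have "a (Suc k) * (\<gamma> (Suc k) - \<gamma> k) \<le> a j * (\<gamma> (Suc k) - \<gamma> k)"
    using up anti[of j "Suc k"] step \<open>1 \<le> j\<close> by (intro mult_right_mono) auto
  ultimately show ?case
    using up eq IH by (auto simp: algebra_simps)
qed

text \<open>Type \<open>m\<close> has positive probability on every subcarrier, so each inner sum
  grows strictly; \<open>N \<ge> 1\<close> makes the outer sum nonempty.\<close>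

lemma objective_lower_transfers:
  assumes "N \<ge> 1" and pos: "\<And>k n. k \<in> {1..K} \<Longrightarrow> n \<in> {1..N} \<Longrightarrow> \<pi> k n > 0"
    and le: "\<And>k. k \<in> {1..K} \<Longrightarrow> t' k \<le> t k" and m: "m \<in> {1..K}" "t' m < t m"
  shows "objective N K \<pi> U \<gamma> t < objective N K \<pi> U \<gamma> t'"
proof -
  have *: "(\<Sum>k=1..K. \<pi> k n * (U (\<gamma> k) - t k)) < (\<Sum>k=1..K. \<pi> k n * (U (\<gamma> k) - t' k))"
    if n: "n \<in> {1..N}" for n
  proof (rule sum_strict_mono_ex1)
    show "\<forall>k\<in>{1..K}. \<pi> k n * (U (\<gamma> k) - t k) \<le> \<pi> k n * (U (\<gamma> k) - t' k)"
      using pos[OF _ n] le by (auto intro!: mult_left_mono simp: less_imp_le)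
    show "\<exists>k\<in>{1..K}. \<pi> k n * (U (\<gamma> k) - t k) < \<pi> k n * (U (\<gamma> k) - t' k)"
      using pos[OF m(1) n] m by (intro bexI[of _ m] mult_strict_left_mono) auto
  qed simp
  show ?thesis
    unfolding objective_def using \<open>N \<ge> 1\<close> by (intro sum_strict_mono[OF _ _ *]) auto
qed

text \<open>Only a type \<open>k \<ge> m\<close> tempted by some \<open>j < m\<close> loses from the
  change. The chain \<open>k\<close>, \<open>m\<close>, \<open>m - 1\<close>, \<open>j\<close>
  contains the slack constraint, which pays for that loss.\<close>

lemma feasible_lower_transfers:
  fixes c :: real and \<delta> :: "nat \<Rightarrow> real"
  defines "a \<equiv> \<lambda>k. c / \<delta> k"
  assumes anti: "\<And>i l. 1 \<le> i \<Longrightarrow> i < l \<Longrightarrow> l \<le> K \<Longrightarrow> a l < a i"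
    and feas: "feasible K c \<delta> \<gamma> t" and m: "m \<in> {2..K}" and "\<epsilon> \<ge> 0"
    and slack: "t (m - 1) - t m \<le> a m * (\<gamma> (m - 1) - \<gamma> m) - \<epsilon>"
  shows "feasible K c \<delta> \<gamma> (\<lambda>k. if m \<le> k then t k - \<epsilon> else t k)" (is "feasible K c \<delta> \<gamma> ?t")
proof -
  have ge0: "\<gamma> k \<ge> 0" and IR: "t k - a k * \<gamma> k \<ge> 0" if "k \<in> {1..K}" for k
    using feas that by (auto simp: feasible_def IR_def relay_cost_eq a_def)
  have IC: "t j - t k \<le> a k * (\<gamma> j - \<gamma> k)" if "k \<in> {1..K}" "j \<in> {1..K}" for k j
    using feas that unfolding feasible_def IC_iff a_def by blast
  have mono: "\<gamma> j \<le> \<gamma> k" if "1 \<le> j" "j < k" "k \<le> K" for j k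
    using anti that IC by (intro incentive_compatible_imp_mono[of a k j t \<gamma>]) auto
  have IC': "?t j - ?t k \<le> a k * (\<gamma> j - \<gamma> k)" if k: "k \<in> {1..K}" and j: "j \<in> {1..K}" for k j
  proof (cases "j < m \<and> m \<le> k")
    case True
    \<comment> \<open>The slack is known for type \<open>m\<close> only; a type
      \<open>k \<ge> m\<close> has no larger unit cost, so it gains at least as much by choosing
      item \<open>m\<close> over item \<open>m - 1\<close>.\<close>
    have "a k * (\<gamma> m - \<gamma> (m - 1)) \<le> a m * (\<gamma> m - \<gamma> (m - 1))"
      using True k m anti[of m k] mono[of "m - 1" m]
      by (cases "k = m") (auto intro!: mult_right_mono)
    moreover have "a k * (\<gamma> (m - 1) - \<gamma> j) \<le> a (m - 1) * (\<gamma> (m - 1) - \<gamma> j)"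
    proof (rule mult_right_mono)
      show "a k \<le> a (m - 1)"
        using True k m by (intro less_imp_le[OF anti]) auto
      show "0 \<le> \<gamma> (m - 1) - \<gamma> j"
        using True j m mono[of j "m - 1"] by (cases "j = m - 1") auto
    qed
    moreover have "t m - t k \<le> a k * (\<gamma> m - \<gamma> k)" "t j - t (m - 1) \<le> a (m - 1) * (\<gamma> j - \<gamma> (m - 1))"
      using True m by (auto intro!: IC k j)
    ultimately show ?thesis
      using True slack by (auto simp: algebra_simps)
  next
    case False
    then show ?thesis
      using IC[OF k j] \<open>\<epsilon> \<ge> 0\<close> by auto
  qed
  have IR': "?t k - a k * \<gamma> k \<ge> 0" if k: "k \<in> {1..K}" for k
  proof (cases "m \<le> k")
    case True
    \<comment> \<open>Participation of type \<open>k\<close> comes from imitating type 1: its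
      transfer is unchanged since \<open>m \<ge> 2\<close>, and its item costs type \<open>k\<close>
      no more than type 1.\<close>
    have "a k * \<gamma> 1 \<le> a 1 * \<gamma> 1"
      using True k m anti[of 1 k] ge0[of 1] by (intro mult_right_mono) auto
    moreover have "0 \<le> t 1 - a 1 * \<gamma> 1"
      using m by (intro IR) auto
    moreover have "t 1 - ?t k \<le> a k * (\<gamma> 1 - \<gamma> k)"
      using IC'[OF k, of 1] m by auto
    ultimately show ?thesis
      unfolding right_diff_distrib by linarith
  next
    case False
    then show ?thesis using IR[OF k] by simp
  qed
  show ?thesis
    using ge0 IC' IR' unfolding feasible_def IC_iff IR_def relay_cost_eq a_def by blast
qed

theorem theorem2:
  fixes N K :: nat
    and c :: real
    and \<delta> :: "nat \<Rightarrow> real"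
    and \<pi> :: "nat \<Rightarrow> nat \<Rightarrow> real"
    and U :: "real \<Rightarrow> real"
  assumes "N \<ge> 1"
    and "K \<ge> 1"
    and "c > 0"
    and "\<And>k. k \<in> {1..K} \<Longrightarrow> \<delta> k > 0"
    and "strict_mono_on {1..K} \<delta>"
    and "\<And>k n. k \<in> {1..K} \<Longrightarrow> n \<in> {1..N} \<Longrightarrow> \<pi> k n > 0"
    and "\<And>n. n \<in> {1..N} \<Longrightarrow> (\<Sum>k=1..K. \<pi> k n) = 1"
    and "concave_on {0..} U"
  shows "(\<forall>\<gamma> t. optimal N K c \<delta> \<pi> U \<gamma> t \<longrightarrow> monotone_snr K \<gamma> \<and> downward_binding K c \<delta> \<gamma> t) \<and>
         (\<forall>\<gamma> t. monotone_snr K \<gamma> \<and> downward_binding K c \<delta> \<gamma> t \<longrightarrow>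
            (\<forall>k\<in>{1..K}. \<forall>j\<in>{1..K}. IC c \<delta> \<gamma> t k j))"
proof -
  define a where "a k = c / \<delta> k" for k
  have anti: "a k < a j" if "1 \<le> j" "j < k" "k \<le> K" for j k
    unfolding a_def by (rule unit_cost_antimono[OF assms(3-5) that])
  have binding_iff: "downward_binding K c \<delta> \<gamma> t \<longleftrightarrow>
      (\<forall>k\<in>{2..K}. t k - t (k - 1) = a k * (\<gamma> k - \<gamma> (k - 1)))" for \<gamma> t
    unfolding downward_binding_def relay_cost_eq a_def
    by (intro ball_cong refl) (simp only: right_diff_distrib, linarith)
  show ?thesis
  proof (intro conjI allI impI)
    fix \<gamma> t
    assume opt: "optimal N K c \<delta> \<pi> U \<gamma> t"
    then have feas: "feasible K c \<delta> \<gamma> t"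
      by (simp add: optimal_def)
    have IC: "t j - t k \<le> a k * (\<gamma> j - \<gamma> k)" if "k \<in> {1..K}" "j \<in> {1..K}" for k j
      using feas that unfolding feasible_def IC_iff a_def by blast
    have "\<gamma> (k - 1) \<le> \<gamma> k" if "k \<in> {2..K}" for k
      using anti that by (intro incentive_compatible_imp_mono[of a k "k - 1" t \<gamma>] IC) auto
    then show "monotone_snr K \<gamma>"
      using feas \<open>K \<ge> 1\<close> by (auto simp: monotone_snr_def feasible_def)
    show "downward_binding K c \<delta> \<gamma> t"
      unfolding binding_iff
    proof (rule ballI, rule ccontr)
      fix m
      assume m: "m \<in> {2..K}" and ne: "t m - t (m - 1) \<noteq> a m * (\<gamma> m - \<gamma> (m - 1))"
      \<comment> \<open>The full slack of the constraint of \<open>m\<close> against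
        \<open>m - 1\<close>, the largest cut that this constraint allows.\<close>
      define \<epsilon> where "\<epsilon> = a m * (\<gamma> (m - 1) - \<gamma> m) - (t (m - 1) - t m)"
      have "\<epsilon> > 0"
      proof -
        have "t (m - 1) - t m \<le> a m * (\<gamma> (m - 1) - \<gamma> m)"
          using m by (intro IC) auto
        with ne show ?thesis
          by (auto simp: \<epsilon>_def algebra_simps)
      qed
      let ?t = "\<lambda>k. if m \<le> k then t k - \<epsilon> else t k"
      have "feasible K c \<delta> \<gamma> ?t"
        using anti m feas \<open>\<epsilon> > 0\<close> unfolding a_def
        by (intro feasible_lower_transfers) (auto simp: \<epsilon>_def a_def)
      moreover have "objective N K \<pi> U \<gamma> t < objective N K \<pi> U \<gamma> ?t"
        using assms(1,6) m \<open>\<epsilon> > 0\<close> by (intro objective_lower_transfers[where m = m]) auto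
      ultimately show False
        using opt unfolding optimal_def by (meson not_less)
    qed
  next
    fix \<gamma> t
    assume "monotone_snr K \<gamma> \<and> downward_binding K c \<delta> \<gamma> t"
    then have mono: "\<And>k. k \<in> {2..K} \<Longrightarrow> \<gamma> (k - 1) \<le> \<gamma> k"
      and bind: "\<And>k. k \<in> {2..K} \<Longrightarrow> t k - t (k - 1) = a k * (\<gamma> k - \<gamma> (k - 1))"
      unfolding monotone_snr_def binding_iff by auto
    note bounds = binding_adjacent_imp_bounds[of K a \<gamma> t, OF anti mono bind]
    have "t j - t k \<le> a k * (\<gamma> j - \<gamma> k)" if "k \<in> {1..K}" "j \<in> {1..K}" for k j
    \<comment> \<open>A downward deviation is excluded by the lower bound, an upward one by the
      upper bound with the indices exchanged.\<close>
    proof (cases "j \<le> k")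
      case True
      then show ?thesis using bounds[of j k] that by (auto simp: algebra_simps)
    next
      case False
      then show ?thesis using bounds[of k j] that by auto
    qed
    then show "\<forall>k\<in>{1..K}. \<forall>j\<in>{1..K}. IC c \<delta> \<gamma> t k j"
      by (simp add: IC_iff a_def)
  qed
qed

end
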